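(* Let $G$ be a finite undirected graph (multiple edges and loops allowed), and let $a\in\mathrm{Fisg}(G)$ with $a:H\to K$. Let $$\langle a\rangle:=\{\varphi\in\mathrm{Fisg}(G)\mid \varphi:L\to M,\ L \text{ and } M \text{ are isomorphic to a subgraph of } H\}.$$ Then $\langle a\rangle=\bigcap_i I_i$, where the intersection runs over all ideals $I_i$ of $\mathrm{Fisg}(G)$ containing $a$.
   Context: Graphs are finite and undirected and may have multiple edges and loops; the empty graph $\emptyset$ counts as a graph (and as a subgraph of every graph) and the empty map $\mu_0:\emptyset\to\emptyset$ counts as a graph isomorphism. For a graph $G$, $\mathrm{Fisg}(G)$ is the set of all graph isomorphisms $\varphi:H\to J$ (bijections on vertices and on edges preserving incidence) where $H$ and $J$ are subgraphs of $G$. For $\varphi,\psi\in\mathrm{Fisg}(G)$ the product $\psi\circ\varphi$ is the composition of partial maps, with domain $\varphi^{-1}(\mathrm{Im}(\varphi)\cap\mathrm{Dom}(\psi))$ and image $\psi(\mathrm{Im}(\varphi)\cap\mathrm{Dom}(\psi))$. With this product $\mathrm{Fisg}(G)$ is an inverse semigroup. An ideal of a semigroup $S$ is a subset $I\subseteq S$ with $SI\subseteq I$ and $IS\subseteq I$. *)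

theory Defs
  imports "HOL-Library.Uprod"
begin

text \<open>
  Every edge carries the unordered pair of its ends, with \<open>Upair v v\<close> for a loop at \<open>v\<close>; edges
  are named, so parallel edges are allowed. The function \<open>ends\<close> is only meaningful on \<open>edges\<close>.
\<close>

record ('v, 'e) mgraph =
  verts :: "'v set"
  edges :: "'e set"
  ends :: "'e \<Rightarrow> 'v uprod"

definition fin_graph :: "('v, 'e) mgraph \<Rightarrow> bool" where
  "fin_graph G \<longleftrightarrow> finite (verts G) \<and> finite (edges G) \<and>
     (\<forall>e\<in>edges G. set_uprod (ends G e) \<subseteq> verts G)"

definition subgraph :: "('v, 'e) mgraph \<Rightarrow> ('v, 'e) mgraph \<Rightarrow> bool" where
  "subgraph H G \<longleftrightarrow> fin_graph H \<and> verts H \<subseteq> verts G \<and> edges H \<subseteq> edges G \<and>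
     (\<forall>e\<in>edges H. ends H e = ends G e)"

text \<open>
  Maps between graphs are pairs of partial maps, one on vertices and one on edges. The domain and
  the range of an isomorphism can thus be read off from the pair, so that isomorphisms between
  different subgraphs of one graph live in a single type, and the composition of partial maps is
  the library's \<open>map_comp\<close>.
\<close>

type_synonym ('v, 'e, 'w, 'f) gmap = "('v \<rightharpoonup> 'w) \<times> ('e \<rightharpoonup> 'f)"

definition graph_iso ::
  "('v, 'e, 'w, 'f) gmap \<Rightarrow> ('v, 'e) mgraph \<Rightarrow> ('w, 'f) mgraph \<Rightarrow> bool" where
  "graph_iso \<phi> H J \<longleftrightarrow>
     dom (fst \<phi>) = verts H \<and> ran (fst \<phi>) = verts J \<and> inj_on (fst \<phi>) (verts H) \<and>
     dom (snd \<phi>) = edges H \<and> ran (snd \<phi>) = edges J \<and> inj_on (snd \<phi>) (edges H) \<and>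
     (\<forall>e\<in>edges H. ends J (the (snd \<phi> e)) = map_uprod (\<lambda>v. the (fst \<phi> v)) (ends H e))"

definition isomorphic :: "('v, 'e) mgraph \<Rightarrow> ('w, 'f) mgraph \<Rightarrow> bool" where
  "isomorphic H J \<longleftrightarrow> (\<exists>\<phi>. graph_iso \<phi> H J)"

definition sub_iso ::
  "('v, 'e) mgraph \<Rightarrow> ('v, 'e, 'v, 'e) gmap \<Rightarrow> ('v, 'e) mgraph \<Rightarrow> ('v, 'e) mgraph \<Rightarrow> bool" where
  "sub_iso G \<phi> H J \<longleftrightarrow> subgraph H G \<and> subgraph J G \<and> graph_iso \<phi> H J"

definition Fisg :: "('v, 'e) mgraph \<Rightarrow> ('v, 'e, 'v, 'e) gmap set" where
  "Fisg G = {\<phi>. \<exists>H J. sub_iso G \<phi> H J}"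

definition gcomp ::
  "('v, 'e, 'v, 'e) gmap \<Rightarrow> ('v, 'e, 'v, 'e) gmap \<Rightarrow> ('v, 'e, 'v, 'e) gmap" where
  "gcomp \<psi> \<phi> = (fst \<psi> \<circ>\<^sub>m fst \<phi>, snd \<psi> \<circ>\<^sub>m snd \<phi>)"

definition semigroup_ideal :: "'s set \<Rightarrow> ('s \<Rightarrow> 's \<Rightarrow> 's) \<Rightarrow> 's set \<Rightarrow> bool" where
  "semigroup_ideal S mul I \<longleftrightarrow>
     I \<subseteq> S \<and> (\<forall>s\<in>S. \<forall>x\<in>I. mul s x \<in> I) \<and> (\<forall>x\<in>I. \<forall>s\<in>S. mul x s \<in> I)"

text \<open>
  The domain and the image of a composite are \<open>f\<close>-preimage and \<open>g\<close>-image of the intersection of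
  the image of \<open>f\<close> with the domain of \<open>g\<close>, as required of the product in \<open>Fisg\<close>.
\<close>

lemma dom_map_comp_eq: "dom (g \<circ>\<^sub>m f) = {x. \<exists>y. f x = Some y \<and> y \<in> ran f \<inter> dom g}"
  by (auto simp: map_comp_def ran_def dom_def split: option.splits)

lemma ran_map_comp_eq: "ran (g \<circ>\<^sub>m f) = {z. \<exists>y \<in> ran f \<inter> dom g. g y = Some z}"
  by (fastforce simp: map_comp_def ran_def dom_def split: option.splits)

end

theory Submission imports Defs begin

text \<open>
  An element of \<open>Fisg G\<close> lies in \<open>\<langle>a\<rangle>\<close> as soon as its domain embeds in \<open>H\<close>, and the domain and the
  image of a product are isomorphic and embed in the domain and the image of each factor, so
  \<open>\<langle>a\<rangle>\<close> is an ideal. Conversely, if \<open>\<beta>\<close> maps the domain of \<open>\<phi>\<close> isomorphically onto a subgraph of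
  \<open>H\<close>, then \<open>\<phi> = \<phi> \<circ> \<beta>\<inverse> \<circ> a\<inverse> \<circ> a \<circ> \<beta>\<close>, which lies in every ideal containing \<open>a\<close>.
\<close>

section \<open>Inverses of injective partial maps\<close>

definition map_inv :: "('a \<rightharpoonup> 'b) \<Rightarrow> ('b \<rightharpoonup> 'a)" where
  "map_inv f y = (if y \<in> ran f then Some (SOME x. f x = Some y) else None)"

text \<open>Under injectivity the preimage picked by \<open>SOME\<close> is the only one, so the
  graph of \<open>map_inv f\<close> is the converse of that of \<open>f\<close>.\<close>

lemma map_inv_eq_Some_iff:
  assumes "inj_on f (dom f)"
  shows "map_inv f y = Some x \<longleftrightarrow> f x = Some y"
proof
  assume "map_inv f y = Some x"
  then have "y \<in> ran f" and x: "x = (SOME x. f x = Some y)"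
    by (auto simp: map_inv_def split: if_splits)
  then show "f x = Some y"
    unfolding x ran_def by (auto intro: someI)
next
  assume fx: "f x = Some y"
  then have "(SOME x. f x = Some y) = x"
    by (intro some_equality) (auto intro: inj_onD[OF assms])
  with fx show "map_inv f y = Some x"
    by (auto simp: map_inv_def ran_def)
qed

lemma dom_map_inv [simp]: "dom (map_inv f) = ran f"
  by (auto simp: map_inv_def dom_def)

lemma ran_map_inv:
  assumes "inj_on f (dom f)"
  shows "ran (map_inv f) = dom f"
  by (auto simp: ran_def dom_def map_inv_eq_Some_iff[OF assms])

lemma inj_on_map_inv:
  assumes "inj_on f (dom f)"
  shows "inj_on (map_inv f) (ran f)"
  by (rule inj_onI) (metis assms dom_map_inv domD map_inv_eq_Some_iff option.inject)

text \<open>By the range condition, following \<open>g\<close> by \<open>f\<close> loses no point of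
  \<open>dom g\<close>, so inverting \<open>f\<close> recovers every value. This removes
  \<open>a\<close> from \<open>a\<inverse> \<circ> a \<circ> \<beta>\<close>.\<close>

lemma map_inv_comp_cancel:
  assumes "inj_on f (dom f)" and "ran g \<subseteq> dom f"
  shows "map_inv f \<circ>\<^sub>m (f \<circ>\<^sub>m g) = g"
proof
  fix x
  show "(map_inv f \<circ>\<^sub>m (f \<circ>\<^sub>m g)) x = g x"
  proof (cases "g x")
    case (Some y)
    with assms(2) obtain z where "f y = Some z"
      by (auto simp: ran_def dom_def)
    with Some assms(1) show ?thesis
      by (simp add: map_inv_eq_Some_iff)
  qed simp
qed

text \<open>\<open>map_inv g \<circ>\<^sub>m g\<close> is the identity on \<open>dom g\<close>; as
  \<open>f\<close> has that very domain, composing with it neither cuts \<open>f\<close> down nor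
  changes its values.\<close>

lemma map_comp_inv_cancel:
  assumes "inj_on g (dom g)" and "dom f = dom g"
  shows "f \<circ>\<^sub>m (map_inv g \<circ>\<^sub>m g) = f"
proof
  fix x
  show "(f \<circ>\<^sub>m (map_inv g \<circ>\<^sub>m g)) x = f x"
  proof (cases "g x")
    case None
    with assms(2) have "f x = None" by blast
    with None show ?thesis by simp
  next
    case (Some y)
    with assms(1) show ?thesis
      by (simp add: map_inv_eq_Some_iff)
  qed
qed

text \<open>Inverting, restricting and inverting again restricts \<open>f\<close> on its image side.\<close>

lemma map_comp_restrict:
  assumes "inj_on f (dom f)"
  shows "(g |` (ran f \<inter> dom g)) \<circ>\<^sub>m map_inv (map_inv f |` (ran f \<inter> dom g)) = g \<circ>\<^sub>m f"
proof
  let ?P = "ran f \<inter> dom g"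
  fix x
  have "inj_on (map_inv f |` ?P) (dom (map_inv f |` ?P))"
    using inj_on_map_inv[OF assms] by (auto simp: inj_on_def)
  then have eq: "map_inv (map_inv f |` ?P) x = Some y \<longleftrightarrow> f x = Some y \<and> y \<in> ?P" for y
    by (auto simp: map_inv_eq_Some_iff restrict_map_def assms)
  show "((g |` ?P) \<circ>\<^sub>m map_inv (map_inv f |` ?P)) x = (g \<circ>\<^sub>m f) x"
  proof (cases "map_inv (map_inv f |` ?P) x")
    case None
    then have "\<And>y. f x = Some y \<Longrightarrow> g y = None"
      using eq by (force simp: ran_def)
    with None show ?thesis by (cases "f x") auto
  next
    case (Some y)
    then show ?thesis using eq[of y] by simp
  qed
qed

section \<open>Inverse and restriction of graph maps, intersection of graphs\<close>

definition gmap_inv :: "('v, 'e, 'w, 'f) gmap \<Rightarrow> ('w, 'f, 'v, 'e) gmap" where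
  "gmap_inv \<phi> = (map_inv (fst \<phi>), map_inv (snd \<phi>))"

definition gmap_restrict ::
  "('v, 'e, 'w, 'f) gmap \<Rightarrow> ('v, 'e) mgraph \<Rightarrow> ('v, 'e, 'w, 'f) gmap" where
  "gmap_restrict \<phi> H = (fst \<phi> |` verts H, snd \<phi> |` edges H)"

text \<open>The choice of \<open>ends H\<close> is asymmetric only in form: for subgraphs of one
  graph, \<open>ends H\<close> and \<open>ends J\<close> agree on the common edges.\<close>

definition graph_inter :: "('v, 'e) mgraph \<Rightarrow> ('v, 'e) mgraph \<Rightarrow> ('v, 'e) mgraph" where
  "graph_inter H J = \<lparr>verts = verts H \<inter> verts J, edges = edges H \<inter> edges J, ends = ends H\<rparr>"

lemma subgraph_refl: "fin_graph H \<Longrightarrow> subgraph H H"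
  by (auto simp: subgraph_def)

lemma subgraph_trans: "subgraph H J \<Longrightarrow> subgraph J G \<Longrightarrow> subgraph H G"
  by (auto simp: subgraph_def)

text \<open>Both graphs inherit their incidence from \<open>G\<close>, so the ends of a common edge
  lie in both vertex sets.\<close>

lemma subgraph_graph_inter:
  assumes "subgraph H G" and "subgraph J G"
  shows "subgraph (graph_inter H J) H" and "subgraph (graph_inter H J) J"
proof -
  have "ends H e = ends J e" if "e \<in> edges H" "e \<in> edges J" for e
    using assms that by (simp add: subgraph_def)
  moreover have "set_uprod (ends H e) \<subseteq> verts H" if "e \<in> edges H" for e
    using assms(1) that unfolding subgraph_def fin_graph_def by blast
  moreover have "set_uprod (ends J e) \<subseteq> verts J" if "e \<in> edges J" for e
    using assms(2) that unfolding subgraph_def fin_graph_def by blast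
  ultimately show "subgraph (graph_inter H J) H" and "subgraph (graph_inter H J) J"
    using assms by (simp_all add: subgraph_def fin_graph_def graph_inter_def)
qed

section \<open>Inverting, composing and restricting graph isomorphisms\<close>

lemma graph_iso_inj:
  assumes "graph_iso \<phi> H J"
  shows "inj_on (fst \<phi>) (dom (fst \<phi>))" and "inj_on (snd \<phi>) (dom (snd \<phi>))"
  using assms by (auto simp: graph_iso_def)

lemma graph_iso_ends:
  assumes "graph_iso \<phi> H J" and "snd \<phi> e = Some f"
  shows "ends J f = map_uprod (\<lambda>v. the (fst \<phi> v)) (ends H e)"
  using assms unfolding graph_iso_def by (metis domI option.sel)

lemma map_uprod_eq_self:
  assumes "\<And>x. x \<in> set_uprod p \<Longrightarrow> f x = x"
  shows "map_uprod f p = p"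
  using assms uprod.map_cong0[of p f id] by (simp add: uprod.map_id)

text \<open>The assumption \<open>fin_graph H\<close> enters through incidence: the ends of an edge
  lie in \<open>verts H\<close>, where the vertex map is defined, so \<open>the\<close> returns
  genuine values and the inverse undoes them.\<close>

lemma graph_iso_inverse:
  assumes iso: "graph_iso \<phi> H J" and fin: "fin_graph H"
  shows "graph_iso (gmap_inv \<phi>) J H"
proof -
  note inj = graph_iso_inj[OF iso]
  have "ends H (the (map_inv (snd \<phi>) f)) = map_uprod (\<lambda>w. the (map_inv (fst \<phi>) w)) (ends J f)"
    if "f \<in> edges J" for f
  proof -
    from that iso have "f \<in> ran (snd \<phi>)" by (simp add: graph_iso_def)
    then obtain e where e: "snd \<phi> e = Some f" by (auto simp: ran_def)
    with iso have eH: "e \<in> edges H" by (auto simp: graph_iso_def)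
    have "the (map_inv (fst \<phi>) (the (fst \<phi> v))) = v" if "v \<in> set_uprod (ends H e)" for v
    proof -
      from that fin eH iso obtain w where "fst \<phi> v = Some w"
        unfolding fin_graph_def graph_iso_def by blast
      then have "map_inv (fst \<phi>) w = Some v" by (simp add: map_inv_eq_Some_iff inj)
      with \<open>fst \<phi> v = Some w\<close> show ?thesis by simp
    qed
    then have "map_uprod (\<lambda>w. the (map_inv (fst \<phi>) w)) (ends J f) = ends H e"
      by (simp add: graph_iso_ends[OF iso e] uprod.map_comp map_uprod_eq_self)
    moreover have "map_inv (snd \<phi>) f = Some e"
      using e by (simp add: map_inv_eq_Some_iff inj)
    ultimately show ?thesis by simp
  qed
  moreover have "inj_on (map_inv (fst \<phi>)) (verts J)" "inj_on (map_inv (snd \<phi>)) (edges J)"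
    using inj_on_map_inv[OF inj(1)] inj_on_map_inv[OF inj(2)] iso by (auto simp: graph_iso_def)
  ultimately show ?thesis
    using iso by (simp add: graph_iso_def gmap_inv_def ran_map_inv)
qed

lemma graph_iso_comp:
  assumes \<phi>: "graph_iso \<phi> H J" and \<psi>: "graph_iso \<psi> J K" and fin: "fin_graph H"
  shows "graph_iso (gcomp \<psi> \<phi>) H K"
proof -
  \<comment> \<open>The type \<open>'x\<close> is generic, so this one fact serves both the vertex
    and the edge component.\<close>
  have aux: "dom (g \<circ>\<^sub>m f) = dom f \<and> ran (g \<circ>\<^sub>m f) = ran g \<and> inj_on (g \<circ>\<^sub>m f) (dom f)"
    if "inj_on f (dom f)" "inj_on g (dom g)" "ran f = dom g" for f :: "'x \<rightharpoonup> 'x" and g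
  proof (intro conjI)
    show "dom (g \<circ>\<^sub>m f) = dom f"
      using that(3) ranI[of f] unfolding dom_map_comp_eq by blast
    show "ran (g \<circ>\<^sub>m f) = ran g"
      using that(3) unfolding ran_map_comp_eq by (auto simp: ran_def)
    show "inj_on (g \<circ>\<^sub>m f) (dom f)"
    proof (rule inj_onI)
      fix x y assume xy: "x \<in> dom f" "y \<in> dom f" "(g \<circ>\<^sub>m f) x = (g \<circ>\<^sub>m f) y"
      then obtain u v where uv: "f x = Some u" "f y = Some v" by blast
      then have "u \<in> dom g" "v \<in> dom g" using that(3) by (auto intro: ranI)
      with that(2) xy(3) uv have "u = v" by (auto dest: inj_onD)
      with inj_onD[OF that(1) _ xy(1,2)] uv show "x = y" by simp
    qed
  qed
  have "ends K (the ((snd \<psi> \<circ>\<^sub>m snd \<phi>) e)) =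
      map_uprod (\<lambda>v. the ((fst \<psi> \<circ>\<^sub>m fst \<phi>) v)) (ends H e)" if e: "e \<in> edges H" for e
  proof -
    from e \<phi> obtain f where f: "snd \<phi> e = Some f" unfolding graph_iso_def by blast
    with \<phi> have "f \<in> edges J" by (auto simp: graph_iso_def intro: ranI)
    with \<psi> obtain g where g: "snd \<psi> f = Some g" unfolding graph_iso_def by blast
    have "the (fst \<psi> (the (fst \<phi> v))) = the ((fst \<psi> \<circ>\<^sub>m fst \<phi>) v)"
      if "v \<in> set_uprod (ends H e)" for v
    proof -
      from that fin e \<phi> obtain w where "fst \<phi> v = Some w"
        unfolding fin_graph_def graph_iso_def by blast
      then show ?thesis by simp
    qed
    then have "map_uprod (\<lambda>v. the (fst \<psi> (the (fst \<phi> v)))) (ends H e) =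
        map_uprod (\<lambda>v. the ((fst \<psi> \<circ>\<^sub>m fst \<phi>) v)) (ends H e)"
      by (rule uprod.map_cong0)
    then show ?thesis
      by (simp add: f g graph_iso_ends[OF \<psi> g] graph_iso_ends[OF \<phi> f] uprod.map_comp comp_def)
  qed
  then show ?thesis
    using aux[of "fst \<phi>" "fst \<psi>"] aux[of "snd \<phi>" "snd \<psi>"] \<phi> \<psi>
    by (simp add: graph_iso_def gcomp_def)
qed

text \<open>The image of \<open>H'\<close> is closed under incidence: the ends of an image edge are
  the images of the ends of its preimage, and these lie in \<open>verts H'\<close>. With
  \<open>ends\<close> taken from \<open>J\<close>, the image is therefore a subgraph.\<close>

lemma graph_iso_restrict:
  assumes iso: "graph_iso \<phi> H J" and sub: "subgraph H' H"
  obtains J' where "subgraph J' J" and "graph_iso (gmap_restrict \<phi> H') H' J'"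
proof
  let ?J' = "\<lparr>verts = ran (fst \<phi> |` verts H'), edges = ran (snd \<phi> |` edges H'), ends = ends J\<rparr>"
  have fin: "fin_graph H'" and vs: "verts H' \<subseteq> dom (fst \<phi>)" and es: "edges H' \<subseteq> dom (snd \<phi>)"
    using sub iso by (auto simp: subgraph_def graph_iso_def)
  have ends: "ends J f = map_uprod (\<lambda>v. the ((fst \<phi> |` verts H') v)) (ends H' e)"
    if "e \<in> edges H'" "snd \<phi> e = Some f" for e f
  proof -
    have "ends J f = map_uprod (\<lambda>v. the (fst \<phi> v)) (ends H' e)"
      using graph_iso_ends[OF iso that(2)] sub that(1) by (simp add: subgraph_def)
    also have "\<dots> = map_uprod (\<lambda>v. the ((fst \<phi> |` verts H') v)) (ends H' e)"
      using fin that(1) by (intro uprod.map_cong0) (auto simp: fin_graph_def restrict_map_def)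
    finally show ?thesis .
  qed
  have doms: "dom (fst \<phi> |` verts H') = verts H'" "dom (snd \<phi> |` edges H') = edges H'"
    using vs es by auto
  have "set_uprod (ends J f) \<subseteq> ran (fst \<phi> |` verts H')" if "f \<in> ran (snd \<phi> |` edges H')" for f
  proof -
    from that obtain e where e: "e \<in> edges H'" "snd \<phi> e = Some f"
      by (auto simp: ran_def restrict_map_def split: if_splits)
    have "the ((fst \<phi> |` verts H') v) \<in> ran (fst \<phi> |` verts H')"
      if "v \<in> set_uprod (ends H' e)" for v
      using that fin e(1) doms(1) unfolding fin_graph_def by (metis domD option.sel ranI subsetD)
    then show ?thesis
      using ends[OF e] by (auto simp: uprod.set_map)
  qed
  moreover have "finite (ran (fst \<phi> |` verts H'))" "finite (ran (snd \<phi> |` edges H'))"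
    using fin doms by (auto simp: fin_graph_def intro: finite_ran)
  moreover have "ran (fst \<phi> |` verts H') \<subseteq> verts J" "ran (snd \<phi> |` edges H') \<subseteq> edges J"
    using iso by (auto simp: graph_iso_def ran_def restrict_map_def split: if_splits)
  ultimately show "subgraph ?J' J"
    by (simp add: subgraph_def fin_graph_def)
  have "inj_on (fst \<phi> |` verts H') (verts H')" "inj_on (snd \<phi> |` edges H') (edges H')"
    using inj_on_subset[OF graph_iso_inj(1)[OF iso] vs] inj_on_subset[OF graph_iso_inj(2)[OF iso] es]
    by (simp_all add: inj_on_def)
  moreover have "ends J (the ((snd \<phi> |` edges H') e)) =
      map_uprod (\<lambda>v. the ((fst \<phi> |` verts H') v)) (ends H' e)" if e: "e \<in> edges H'" for e
  proof -
    from e es obtain f where "snd \<phi> e = Some f" by blast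
    with e show ?thesis by (simp add: ends)
  qed
  ultimately show "graph_iso (gmap_restrict \<phi> H') H' ?J'"
    using doms by (simp add: graph_iso_def gmap_restrict_def)
qed

section \<open>Inverses and products in \<open>Fisg G\<close>\<close>

lemma sub_iso_inverse: "sub_iso G \<phi> H J \<Longrightarrow> sub_iso G (gmap_inv \<phi>) J H"
  by (auto simp: sub_iso_def subgraph_def intro: graph_iso_inverse)

text \<open>The product factors through the intersection \<open>?P\<close> of the image of
  \<open>\<phi>\<close> with the domain of \<open>\<psi>\<close>, as an isomorphism from
  \<open>L'\<close> onto \<open>?P\<close> followed by one from \<open>?P\<close> onto
  \<open>N'\<close>.\<close>

lemma sub_iso_gcomp:
  assumes \<phi>: "sub_iso G \<phi> L M" and \<psi>: "sub_iso G \<psi> J N"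
  obtains L' N' where "subgraph L' L" and "subgraph N' N" and "sub_iso G (gcomp \<psi> \<phi>) L' N'"
proof -
  let ?P = "graph_inter M J"
  have sub: "subgraph ?P M" "subgraph ?P J"
    using subgraph_graph_inter[of M G J] \<phi> \<psi> by (auto simp: sub_iso_def)
  then have fin: "fin_graph ?P" by (simp add: subgraph_def)
  \<comment> \<open>\<open>graph_iso_restrict\<close> cuts down domains, so \<open>\<phi>\<close> is
    inverted first in order to cut it down on its image side.\<close>
  have "graph_iso (gmap_inv \<phi>) M L" using sub_iso_inverse[OF \<phi>] by (simp add: sub_iso_def)
  then obtain L' where L': "subgraph L' L" "graph_iso (gmap_restrict (gmap_inv \<phi>) ?P) ?P L'"
    using graph_iso_restrict sub(1) by blast
  obtain N' where N': "subgraph N' N" "graph_iso (gmap_restrict \<psi> ?P) ?P N'"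
    using graph_iso_restrict sub(2) \<psi> unfolding sub_iso_def by blast
  have "gcomp (gmap_restrict \<psi> ?P) (gmap_inv (gmap_restrict (gmap_inv \<phi>) ?P)) = gcomp \<psi> \<phi>"
    using \<phi> \<psi> map_comp_restrict[of "fst \<phi>" "fst \<psi>"] map_comp_restrict[of "snd \<phi>" "snd \<psi>"]
    by (simp add: sub_iso_def graph_iso_def gcomp_def gmap_restrict_def gmap_inv_def graph_inter_def)
  then have "graph_iso (gcomp \<psi> \<phi>) L' N'"
    using graph_iso_comp[OF graph_iso_inverse[OF L'(2) fin] N'(2)] L'(1)
    by (simp add: subgraph_def)
  with L'(1) N'(1) \<phi> \<psi> show thesis
    by (intro that[of L' N']) (auto simp: sub_iso_def intro: subgraph_trans)
qed

section \<open>Embeddability and the ideal generated by \<open>a\<close>\<close>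

definition embeds :: "('v, 'e) mgraph \<Rightarrow> ('v, 'e) mgraph \<Rightarrow> bool" where
  "embeds L H \<longleftrightarrow> (\<exists>H'. subgraph H' H \<and> isomorphic L H')"

lemma embeds_subgraph: "subgraph L' L \<Longrightarrow> embeds L H \<Longrightarrow> embeds L' H"
  unfolding embeds_def isomorphic_def by (meson graph_iso_restrict subgraph_trans)

lemma embeds_iso: "sub_iso G \<phi> L M \<Longrightarrow> embeds M H \<Longrightarrow> embeds L H"
  unfolding embeds_def isomorphic_def sub_iso_def subgraph_def by (meson graph_iso_comp)

lemma embeds_iso_iff: "sub_iso G \<phi> L M \<Longrightarrow> embeds L H \<longleftrightarrow> embeds M H"
  using embeds_iso sub_iso_inverse by metis

text \<open>The identity isomorphism of \<open>H\<close> arises as \<open>\<phi>\<close> followed by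
  its inverse.\<close>

lemma embeds_refl:
  assumes "sub_iso G \<phi> H K"
  shows "embeds H H"
proof -
  have "graph_iso (gcomp (gmap_inv \<phi>) \<phi>) H H"
    using assms sub_iso_inverse[OF assms]
    by (auto simp: sub_iso_def subgraph_def intro: graph_iso_comp)
  then show ?thesis
    using assms subgraph_refl unfolding embeds_def isomorphic_def sub_iso_def subgraph_def by blast
qed

lemma semigroup_ideal_embeds:
  "semigroup_ideal (Fisg G) gcomp {\<phi>. \<exists>L M. sub_iso G \<phi> L M \<and> embeds L H}"
proof -
  \<comment> \<open>The disjunction treats left and right multiplication together. The domain of the
    product lies in \<open>L\<close> and its image in \<open>N\<close>, where \<open>N\<close> is
    isomorphic to \<open>J\<close>; either one embedding in \<open>H\<close> suffices, as the two
    are isomorphic.\<close>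
  have "\<exists>L' N'. sub_iso G (gcomp \<psi> \<phi>) L' N' \<and> embeds L' H"
    if \<phi>: "sub_iso G \<phi> L M" and \<psi>: "sub_iso G \<psi> J N" and "embeds L H \<or> embeds J H" for \<phi> \<psi> L M J N
  proof -
    obtain L' N' where *: "subgraph L' L" "subgraph N' N" "sub_iso G (gcomp \<psi> \<phi>) L' N'"
      using sub_iso_gcomp[OF \<phi> \<psi>] .
    with that show ?thesis by (metis embeds_iso_iff embeds_subgraph)
  qed
  then show ?thesis
    unfolding semigroup_ideal_def Fisg_def by blast
qed

lemma mem_ideal_if_embeds:
  assumes I: "semigroup_ideal (Fisg G) gcomp I" "a \<in> I"
    and a: "sub_iso G a H K" and \<phi>: "sub_iso G \<phi> L M" and emb: "embeds L H"
  shows "\<phi> \<in> I"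
proof -
  obtain H' \<beta> where H': "subgraph H' H" and \<beta>: "graph_iso \<beta> L H'"
    using emb by (auto simp: embeds_def isomorphic_def)
  have \<beta>G: "sub_iso G \<beta> L H'"
    using H' \<beta> \<phi> a subgraph_trans by (auto simp: sub_iso_def)
  have fisg: "x \<in> Fisg G" if "sub_iso G x P Q" for x P Q
    using that by (auto simp: Fisg_def)
  have mulL: "s \<in> Fisg G \<Longrightarrow> x \<in> I \<Longrightarrow> gcomp s x \<in> I"
    and mulR: "s \<in> Fisg G \<Longrightarrow> x \<in> I \<Longrightarrow> gcomp x s \<in> I" for s x
    using I(1) by (auto simp: semigroup_ideal_def)
  have a_iso: "graph_iso a H K" and \<phi>_iso: "graph_iso \<phi> L M"
    using a \<phi> by (auto simp: sub_iso_def)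
  \<comment> \<open>The image \<open>H'\<close> of \<open>\<beta>\<close> lies in the domain
    \<open>H\<close> of \<open>a\<close>, so \<open>a\<close> can be cancelled.\<close>
  have "gcomp (gmap_inv a) (gcomp a \<beta>) = \<beta>"
    using graph_iso_inj[OF a_iso] a_iso \<beta> H'
    by (simp add: gcomp_def gmap_inv_def graph_iso_def subgraph_def map_inv_comp_cancel)
  then have "\<beta> \<in> I"
    using mulL[OF fisg[OF sub_iso_inverse[OF a]] mulR[OF fisg[OF \<beta>G] I(2)]] by simp
  \<comment> \<open>\<open>\<beta>\<close> and \<open>\<phi>\<close> share the domain
    \<open>L\<close>, so the inner product acts as the identity there.\<close>
  moreover have "gcomp \<phi> (gcomp (gmap_inv \<beta>) \<beta>) = \<phi>"
    using graph_iso_inj[OF \<beta>] \<phi>_iso \<beta>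
    by (simp add: gcomp_def gmap_inv_def graph_iso_def map_comp_inv_cancel)
  ultimately show ?thesis
    using mulL[OF fisg[OF \<phi>] mulL[OF fisg[OF sub_iso_inverse[OF \<beta>G]]]] by metis
qed

theorem theorem4p6:
  fixes G H K :: "('v, 'e) mgraph"
    and a :: "('v, 'e, 'v, 'e) gmap"
  assumes "fin_graph G"
    and "a \<in> Fisg G"
    and "sub_iso G a H K"
  shows "{\<phi> \<in> Fisg G. \<exists>L M. sub_iso G \<phi> L M \<and>
            (\<exists>H'. subgraph H' H \<and> isomorphic L H') \<and>
            (\<exists>H'. subgraph H' H \<and> isomorphic M H')}
         = \<Inter> {I. semigroup_ideal (Fisg G) gcomp I \<and> a \<in> I}"
    (is "?A = ?B")
proof -
  let ?C = "{\<phi>. \<exists>L M. sub_iso G \<phi> L M \<and> embeds L H}"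
  \<comment> \<open>Domain and image of an element are isomorphic, so \<open>embeds_iso_iff\<close>
    carries the condition on \<open>L\<close> over to \<open>M\<close>.\<close>
  have "?A = ?C"
    unfolding embeds_def[symmetric] using embeds_iso_iff by (fastforce simp: Fisg_def)
  also have "?C = ?B"
  proof
    show "?C \<subseteq> ?B"
      using mem_ideal_if_embeds[OF _ _ assms(3)] by blast
    have "a \<in> ?C" using assms(3) embeds_refl by blast
    \<comment> \<open>\<open>?C\<close> is itself one of the ideals being intersected.\<close>
    then show "?B \<subseteq> ?C" using semigroup_ideal_embeds[of G H] by blast
  qed
  finally show ?thesis .
qed

end
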